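(* Let $\mathcal I$ be a marriage instance with complete preference lists and the same number of men and women, let $A,b$ be induced by $\mathcal I$, and let $C$ be any ordinal matrix consistent with $\mathcal I$. If a stable matching $\mu$ of $\mathcal I$ is intermediate, then there is no dominating vertex $x$ of $(A,b,C)$ that is the characteristic vector of $\mu$.
   Context: A marriage instance on agents $V=\{v_1,\dots,v_n\}=M\cup W$ is given by the complete bipartite graph between men and women (valid edges $e_{n+1},\dots,e_{n+m}$) plus a loop $e_i$ at each $v_i$, with strict preferences $\succ_v$ of each agent over the edges containing it, loop last. A matching is a set $\mu$ of edges with each agent in exactly one edge of $\mu$; it is stable if no valid edge $(m,w)\notin\mu$ is preferred by both $m$ and $w$ to their edges in $\mu$. $\mu$ is $v$-optimal if $v$'s partner in $\mu$ is $v$'s most preferred among all partners $v$ has in stable matchings; a stable matching is intermediate if it is $v$-optimal for no agent $v$. Induced $A,b$: $A=(I\mid A')\in\{0,1\}^{n\times(n+m)}$, column $j$ corresponds to $e_j$, $I$ identity (loops), $A'$ node-edge incidence matrix of valid edges; $b=(1,\dots,1)^T$. Ordinal matrix: $C\in\mathbb Z^{n\times(n+m)}$ with pairwise distinct entries in each row and $c_{ii}<c_{ik}<c_{ij}$ for $i\ne j\in[n]$, $k\in[n+m]\setminus[n]$. Consistent: (i) if $v_i\in e_j$ and $v_{\bar\imath}\notin e_j$ then $c_{ij}<c_{\bar\imath j}$; (ii) if $v_i\in e_j,e_\ell$ then $c_{ij}>c_{i\ell}$ iff $e_j\succ_{v_i}e_\ell$. Ordinal basis: $n$ columns $D$ such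 that, with $u_i=\min_{j\in D}c_{ij}$, every column $h$ has some $i$ with $u_i\ge c_{ih}$. Dominating vertex: basic feasible solution of $\{x\ge0:Ax=b\}$ associated to a basis $B$ of $A$ with $A_B^{-1}b\ge0$ which is also an ordinal basis of $C$.
   Formalization: Consistency (i) is replaced by a comparison within a row (if v_i is in e_j and not in e_l then c_ij < c_il), since with the printed column comparison the claim fails for a 3-by-3 cyclic instance; the set of agents is also assumed nonempty. *)

theory Defs
  imports Complex_Main "Jordan_Normal_Form.DL_Submatrix"
begin

text \<open>
  Agents, rows and columns are numbered from \<open>0\<close>: the agents are \<open>0..<n\<close>, the columns \<open>0..<n\<close>
  are the loops and the columns \<open>n..<n+m\<close> are the valid edges. An edge is the set of agents it
  contains, so the loop at \<open>i\<close> is \<open>{i}\<close>. The formula \<open>pref I v f g\<close> means \<open>f \<succ>\<^sub>v g\<close>.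
\<close>

record marriage =
  nagents :: nat
  nvalid :: nat
  men :: "nat set"
  women :: "nat set"
  edge :: "nat \<Rightarrow> nat set"
  pref :: "nat \<Rightarrow> nat set \<Rightarrow> nat set \<Rightarrow> bool"

definition agents :: "marriage \<Rightarrow> nat set" where
  "agents I = {0..<nagents I}"

definition valid_edges :: "marriage \<Rightarrow> nat set set" where
  "valid_edges I = edge I ` {nagents I..<nagents I + nvalid I}"

definition edges :: "marriage \<Rightarrow> nat set set" where
  "edges I = edge I ` {0..<nagents I + nvalid I}"

definition edges_at :: "marriage \<Rightarrow> nat \<Rightarrow> nat set set" where
  "edges_at I v = {f \<in> edges I. v \<in> f}"

text \<open>
  The set of agents is nonempty. (For \<open>n = 0\<close> the empty matching would vacuously be
  intermediate, and the empty vector a dominating vertex.)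
\<close>

definition marriage_instance :: "marriage \<Rightarrow> bool" where
  "marriage_instance I \<longleftrightarrow>
     0 < nagents I \<and>
     men I \<union> women I = agents I \<and> men I \<inter> women I = {} \<and>
     (\<forall>i<nagents I. edge I i = {i}) \<and>
     bij_betw (edge I) {nagents I..<nagents I + nvalid I}
       {{a, b} | a b. a \<in> men I \<and> b \<in> women I} \<and>
     (\<forall>v\<in>agents I.
        irreflp_on (edges_at I v) (pref I v) \<and>
        transp_on (edges_at I v) (pref I v) \<and>
        totalp_on (edges_at I v) (pref I v) \<and>
        (\<forall>f\<in>edges_at I v. f \<noteq> {v} \<longrightarrow> pref I v f {v}))"

definition matching :: "marriage \<Rightarrow> nat set set \<Rightarrow> bool" where
  "matching I \<mu> \<longleftrightarrow> \<mu> \<subseteq> edges I \<and> (\<forall>v\<in>agents I. \<exists>!f. f \<in> \<mu> \<and> v \<in> f)"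

definition edge_of :: "nat set set \<Rightarrow> nat \<Rightarrow> nat set" where
  "edge_of \<mu> v = (THE f. f \<in> \<mu> \<and> v \<in> f)"

definition stable_matching :: "marriage \<Rightarrow> nat set set \<Rightarrow> bool" where
  "stable_matching I \<mu> \<longleftrightarrow> matching I \<mu> \<and>
     \<not> (\<exists>f\<in>valid_edges I. f \<notin> \<mu> \<and> (\<forall>v\<in>f. pref I v f (edge_of \<mu> v)))"

text \<open>
  Preferences are over edges, and an edge at \<open>v\<close> determines the partner of \<open>v\<close>.
\<close>

definition optimal_for :: "marriage \<Rightarrow> nat \<Rightarrow> nat set set \<Rightarrow> bool" where
  "optimal_for I v \<mu> \<longleftrightarrow> stable_matching I \<mu> \<and>
     (\<forall>\<nu>. stable_matching I \<nu> \<longrightarrow> edge_of \<nu> v \<noteq> edge_of \<mu> v \<longrightarrow> pref I v (edge_of \<mu> v) (edge_of \<nu> v))"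

definition intermediate :: "marriage \<Rightarrow> nat set set \<Rightarrow> bool" where
  "intermediate I \<mu> \<longleftrightarrow> stable_matching I \<mu> \<and> (\<forall>v\<in>agents I. \<not> optimal_for I v \<mu>)"

definition induced_A :: "marriage \<Rightarrow> real mat" where
  "induced_A I = mat (nagents I) (nagents I + nvalid I)
     (\<lambda>(i, j). if j < nagents I then (if i = j then 1 else 0)
               else (if i \<in> edge I j then 1 else 0))"

definition induced_b :: "marriage \<Rightarrow> real vec" where
  "induced_b I = vec (nagents I) (\<lambda>_. 1)"

definition char_vec :: "marriage \<Rightarrow> nat set set \<Rightarrow> real vec" where
  "char_vec I \<mu> = vec (nagents I + nvalid I) (\<lambda>j. if edge I j \<in> \<mu> then 1 else 0)"

definition ordinal_matrix :: "nat \<Rightarrow> nat \<Rightarrow> int mat \<Rightarrow> bool" where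
  "ordinal_matrix n m C \<longleftrightarrow> C \<in> carrier_mat n (n + m) \<and>
     (\<forall>i<n. inj_on (\<lambda>j. C $$ (i, j)) {0..<n + m}) \<and>
     (\<forall>i<n. \<forall>j<n. \<forall>k\<in>{n..<n + m}. i \<noteq> j \<longrightarrow>
        C $$ (i, i) < C $$ (i, k) \<and> C $$ (i, k) < C $$ (i, j))"

text \<open>
  The first condition compares two entries of the \<^emph>\<open>same row\<close>: an agent's entry at an edge
  containing it is below its entry at an edge not containing it. The source prints it as a
  comparison within a column, \<open>c\<^sub>i\<^sub>j < c\<^sub>k\<^sub>j\<close> for \<open>v\<^sub>i \<in> e\<^sub>j\<close> and \<open>v\<^sub>k \<notin> e\<^sub>j\<close>. That is taken to be a
  misplaced index, for two reasons. Ordinal bases depend only on the order inside each row and are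
  unchanged by increasing transformations of single rows. And with the column condition the
  theorem is false. Take men \<open>0,1,2\<close> and women \<open>3,4,5\<close>, where man \<open>k\<close> ranks \<open>3+k, 3+(k+1), 3+(k+2)\<close>
  and woman \<open>3+k\<close> ranks men \<open>k+1, k+2, k\<close> (all sums of \<open>k\<close> modulo \<open>3\<close>). Let
  \<open>D = {0}, {0,4}, {2,4}, {2,3}, {1,3}, {1,5}\<close>; the associated vertex is the intermediate matching
  \<open>{0,4}, {1,5}, {2,3}\<close>. Let the rows other than row \<open>1\<close> have the entries \<open>0\<close> at the own loop,
  \<open>1,2,3\<close> at the own valid edges, and distinct entries above \<open>1000\<close> at the other valid edges and,
  still higher, at the other loops. Let row \<open>1\<close> have \<open>0\<close> at its loop, entries in \<open>11..30\<close> at the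
  valid edges that neither contain \<open>1\<close> nor lie in \<open>D\<close>, \<open>31,32,33\<close> at its own valid edges, entries
  in \<open>100..200\<close> at the edges of \<open>D\<close> between other agents, and entries above \<open>1000\<close> at the other
  loops. The column condition holds and \<open>D\<close> is an ordinal basis.
\<close>

definition consistent :: "marriage \<Rightarrow> int mat \<Rightarrow> bool" where
  "consistent I C \<longleftrightarrow>
     (\<forall>i<nagents I. \<forall>j<nagents I + nvalid I. \<forall>l<nagents I + nvalid I.
        (i \<in> edge I j \<longrightarrow> i \<notin> edge I l \<longrightarrow> C $$ (i, j) < C $$ (i, l)) \<and>
        (i \<in> edge I j \<longrightarrow> i \<in> edge I l \<longrightarrow>
           (C $$ (i, j) > C $$ (i, l) \<longleftrightarrow> pref I i (edge I j) (edge I l))))"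

definition ordinal_basis :: "int mat \<Rightarrow> nat set \<Rightarrow> bool" where
  "ordinal_basis C D \<longleftrightarrow> D \<subseteq> {0..<dim_col C} \<and> card D = dim_row C \<and>
     (\<forall>h<dim_col C. \<exists>i<dim_row C. Min ((\<lambda>j. C $$ (i, j)) ` D) \<ge> C $$ (i, h))"

abbreviation basis_mat :: "real mat \<Rightarrow> nat set \<Rightarrow> real mat" where
  "basis_mat A B \<equiv> submatrix A UNIV B"

definition column_basis :: "real mat \<Rightarrow> nat set \<Rightarrow> bool" where
  "column_basis A B \<longleftrightarrow> B \<subseteq> {0..<dim_col A} \<and> card B = dim_row A \<and>
     invertible_mat (basis_mat A B)"

text \<open>
  \<open>x\<close> is the basic feasible solution associated to the basis \<open>B\<close>, with \<open>R\<close> the inverse of \<open>A\<^sub>B\<close>;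
  \<open>pick B k\<close> is the \<open>k\<close>-th smallest element of \<open>B\<close>, i.e. the column of \<open>A\<close> that is column \<open>k\<close>
  of \<open>A\<^sub>B\<close>.
\<close>

definition basic_feasible_solution :: "real mat \<Rightarrow> real vec \<Rightarrow> nat set \<Rightarrow> real vec \<Rightarrow> bool" where
  "basic_feasible_solution A b B x \<longleftrightarrow> column_basis A B \<and> x \<in> carrier_vec (dim_col A) \<and>
     (\<exists>R. inverts_mat (basis_mat A B) R \<and> inverts_mat R (basis_mat A B) \<and>
        (\<forall>k<dim_row A. (R *\<^sub>v b) $ k \<ge> 0 \<and> x $ pick B k = (R *\<^sub>v b) $ k)) \<and>
     (\<forall>j<dim_col A. j \<notin> B \<longrightarrow> x $ j = 0)"

definition dominating_vertex :: "real mat \<Rightarrow> real vec \<Rightarrow> int mat \<Rightarrow> real vec \<Rightarrow> bool" where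
  "dominating_vertex A b C x \<longleftrightarrow>
     (\<exists>B. basic_feasible_solution A b B x \<and> ordinal_basis C B)"

end

theory Submission
  imports Defs
begin

text \<open>
  A matrix whose columns are all valid edges has dependent rows (the rows of the men and the rows
  of the women have the same sum), so the basis \<open>D\<close> contains the loop of some agent \<open>v\<close>. Let \<open>X\<close> be
  the side opposite to \<open>v\<close>. As no agent of \<open>X\<close> has its optimal partner in \<open>\<mu>\<close>, joining stable
  matchings in the lattice yields a stable matching in which every agent of \<open>X\<close> is strictly
  better off than in \<open>\<mu>\<close>. Let \<open>x\<close> be the partner of \<open>v\<close> in it. Then no row dominates
  the column of the edge \<open>{x, v}\<close>: row \<open>x\<close> does not because \<open>D\<close> contains the worse edge of \<open>x\<close> in
  \<open>\<mu>\<close>, row \<open>v\<close> does not because \<open>D\<close> contains the loop at \<open>v\<close>, and any other row \<open>i\<close> does not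
  because \<open>D\<close> contains an edge at \<open>i\<close>.
\<close>

section \<open>Edges of a matching, and the market viewed from one side\<close>

lemma edge_of_eqI:
  assumes "matching I \<mu>" "v \<in> agents I" "f \<in> \<mu>" "v \<in> f"
  shows "edge_of \<mu> v = f"
  using assms unfolding matching_def edge_of_def by (metis (mono_tags, lifting) the_equality)

lemma edge_of_matching:
  assumes "matching I \<mu>" "v \<in> agents I"
  shows "edge_of \<mu> v \<in> \<mu>" "v \<in> edge_of \<mu> v"
proof -
  have "\<exists>!f. f \<in> \<mu> \<and> v \<in> f" using assms by (auto simp: matching_def)
  from theI'[OF this] show "edge_of \<mu> v \<in> \<mu>" "v \<in> edge_of \<mu> v" by (auto simp: edge_of_def)
qed

text \<open>Which side is \<open>X\<close> stays open, so each fact is proved once and can be read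
  with men and women in either role. This is needed because the loop in the basis may belong to an
  agent of either side.\<close>

locale market_sides =
  fixes I :: marriage and X Y :: "nat set"
  assumes inst: "marriage_instance I"
    and card_sides: "card X = card Y"
    and sides: "X = men I \<and> Y = women I \<or> X = women I \<and> Y = men I"
begin

lemma agents_eq: "agents I = X \<union> Y" and disjoint: "X \<inter> Y = {}"
  using inst sides by (auto simp: marriage_instance_def)

lemma finite_sides: "finite X" "finite Y"
  using agents_eq by (metis agents_def finite_Un finite_atLeastLessThan)+

lemma valid_edges_eq: "valid_edges I = {{x, y} | x y. x \<in> X \<and> y \<in> Y}"
proof -
  have "valid_edges I = {{a, b} | a b. a \<in> men I \<and> b \<in> women I}"
    using inst by (auto simp: marriage_instance_def valid_edges_def bij_betw_def)
  then show ?thesis using sides by (auto simp: insert_commute)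
qed

lemma edges_eq: "edges I = valid_edges I \<union> (\<lambda>v. {v}) ` agents I"
proof -
  have "{0..<nagents I + nvalid I} = {nagents I..<nagents I + nvalid I} \<union> {0..<nagents I}" by auto
  moreover have "edge I ` {0..<nagents I} = (\<lambda>v. {v}) ` agents I"
    using inst by (auto simp: marriage_instance_def agents_def)
  ultimately show ?thesis by (simp add: edges_def valid_edges_def image_Un)
qed

lemma pair_in_edges_at:
  assumes "x \<in> X" "y \<in> Y"
  shows "{x, y} \<in> edges_at I x" "{x, y} \<in> edges_at I y"
  using assms edges_eq valid_edges_eq by (auto simp: edges_at_def)

lemma pref_irrefl: "v \<in> agents I \<Longrightarrow> f \<in> edges_at I v \<Longrightarrow> \<not> pref I v f f"
  using inst by (auto simp: marriage_instance_def irreflp_on_def)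

lemma pref_trans:
  "\<lbrakk>v \<in> agents I; f \<in> edges_at I v; g \<in> edges_at I v; h \<in> edges_at I v; pref I v f g; pref I v g h\<rbrakk>
    \<Longrightarrow> pref I v f h"
  using inst unfolding marriage_instance_def transp_on_def by blast

lemma pref_total:
  "\<lbrakk>v \<in> agents I; f \<in> edges_at I v; g \<in> edges_at I v; f \<noteq> g\<rbrakk> \<Longrightarrow> pref I v f g \<or> pref I v g f"
  using inst unfolding marriage_instance_def totalp_on_def by blast

lemma pref_loop: "\<lbrakk>v \<in> agents I; f \<in> edges_at I v; f \<noteq> {v}\<rbrakk> \<Longrightarrow> pref I v f {v}"
  using inst unfolding marriage_instance_def by blast

section \<open>Stable matchings as bijections between the sides, and their joins\<close>

lemma edge_of_cases:
  assumes "matching I \<mu>"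
  shows "x \<in> X \<Longrightarrow> edge_of \<mu> x = {x} \<or> (\<exists>y\<in>Y. edge_of \<mu> x = {x, y})"
    and "y \<in> Y \<Longrightarrow> edge_of \<mu> y = {y} \<or> (\<exists>x\<in>X. edge_of \<mu> y = {x, y})"
proof -
  have E: "edge_of \<mu> v \<in> valid_edges I \<union> (\<lambda>v. {v}) ` agents I" "v \<in> edge_of \<mu> v"
    if "v \<in> agents I" for v
    using edge_of_matching[OF assms that] assms edges_eq by (auto simp: matching_def)
  show "x \<in> X \<Longrightarrow> edge_of \<mu> x = {x} \<or> (\<exists>y\<in>Y. edge_of \<mu> x = {x, y})"
    using E[of x] agents_eq disjoint valid_edges_eq by auto
  show "y \<in> Y \<Longrightarrow> edge_of \<mu> y = {y} \<or> (\<exists>x\<in>X. edge_of \<mu> y = {x, y})"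
    using E[of y] agents_eq disjoint valid_edges_eq by auto
qed

text \<open>Since the sides have equal size, a single \<open>a\<close> forces a single
  \<open>b\<close> on the other side. Each of them ranks its loop last, so the pair
  \<open>{a, b}\<close> blocks.\<close>

lemma stable_no_loop:
  assumes st: "stable_matching I \<mu>" and a: "a \<in> X"
  shows "edge_of \<mu> a \<noteq> {a}"
proof
  assume loop: "edge_of \<mu> a = {a}"
  have M: "matching I \<mu>" using st by (simp add: stable_matching_def)
  \<comment> \<open>Counting: if nobody in \<open>Y\<close> were single, the partner map
    \<open>p\<close> would inject \<open>Y\<close> into \<open>X - {a}\<close>, which is too
    small.\<close>
  have "\<exists>b\<in>Y. edge_of \<mu> b = {b}"
  proof (rule ccontr)
    assume "\<not> ?thesis"
    then have "\<forall>b\<in>Y. \<exists>x\<in>X. edge_of \<mu> b = {x, b}" using edge_of_cases(2)[OF M] by blast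
    then obtain p where p: "\<And>b. b \<in> Y \<Longrightarrow> p b \<in> X \<and> edge_of \<mu> b = {p b, b}" by metis
    have p': "edge_of \<mu> (p b) = {p b, b}" if "b \<in> Y" for b
      using edge_of_eqI[OF M, of "p b" "{p b, b}"] edge_of_matching[OF M, of b] p[OF that] that agents_eq
      by auto
    have "inj_on p Y"
    proof (rule inj_onI)
      fix b c assume "b \<in> Y" "c \<in> Y" "p b = p c"
      then have "{p b, b} = {p b, c}" using p' by metis
      then show "b = c" by (auto simp: doubleton_eq_iff)
    qed
    moreover have "p ` Y \<subseteq> X - {a}"
    proof -
      have "p b \<noteq> a" if "b \<in> Y" for b
        using p'[OF that] loop that a disjoint by auto
      then show ?thesis using p by auto
    qed
    ultimately have "card Y \<le> card (X - {a})" using finite_sides by (intro card_inj_on_le) auto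
    also have "\<dots> < card X" using a finite_sides by (intro card_Diff1_less) auto
    finally show False using card_sides by simp
  qed
  then obtain b where b: "b \<in> Y" "edge_of \<mu> b = {b}" by blast
  have ne: "a \<noteq> b" using a b disjoint by auto
  have "{a, b} \<in> valid_edges I" using a b valid_edges_eq by auto
  moreover have "{a, b} \<notin> \<mu>" using edge_of_eqI[OF M, of a "{a,b}"] a agents_eq loop ne by auto
  moreover have "pref I a {a, b} (edge_of \<mu> a)" "pref I b {a, b} (edge_of \<mu> b)"
    using pref_loop[of a "{a,b}"] pref_loop[of b "{a,b}"] pair_in_edges_at[OF a b(1)] loop b a ne agents_eq
    by auto
  ultimately show False using st by (auto simp: stable_matching_def)
qed

text \<open>A perfect stable matching, encoded by the partner map of \<open>X\<close>. Every agent
  of \<open>Y\<close> is written as \<open>f z\<close>, so its current edge is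
  \<open>{z, f z}\<close> and no inverse of \<open>f\<close> is needed to express a blocking
  pair.\<close>

definition stable_fun :: "(nat \<Rightarrow> nat) \<Rightarrow> bool" where
  "stable_fun f \<longleftrightarrow> bij_betw f X Y \<and>
     (\<forall>x\<in>X. \<forall>z\<in>X. \<not> (pref I x {x, f z} {x, f x} \<and> pref I (f z) {x, f z} {z, f z}))"

lemma stable_fun_in: "stable_fun f \<Longrightarrow> x \<in> X \<Longrightarrow> f x \<in> Y"
  by (auto simp: stable_fun_def bij_betw_def)

lemma bij_betwI_sides: "inj_on f X \<Longrightarrow> f ` X \<subseteq> Y \<Longrightarrow> bij_betw f X Y"
  using card_sides finite_sides by (auto simp: bij_betw_def card_image card_subset_eq)

lemma stable_funE:
  assumes st: "stable_matching I \<mu>"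
  obtains f where "stable_fun f" "\<And>x. x \<in> X \<Longrightarrow> edge_of \<mu> x = {x, f x}"
proof -
  have M: "matching I \<mu>" using st by (simp add: stable_matching_def)
  have "\<forall>x\<in>X. \<exists>y\<in>Y. edge_of \<mu> x = {x, y}"
    using edge_of_cases(1)[OF M] stable_no_loop[OF st] by blast
  then obtain f where f: "\<And>x. x \<in> X \<Longrightarrow> f x \<in> Y \<and> edge_of \<mu> x = {x, f x}" by metis
  have f': "edge_of \<mu> (f x) = {x, f x}" if "x \<in> X" for x
    using edge_of_eqI[OF M, of "f x" "{x, f x}"] edge_of_matching[OF M, of x] f[OF that] that agents_eq
    by auto
  have "inj_on f X"
  proof (rule inj_onI)
    fix x z assume "x \<in> X" "z \<in> X" "f x = f z"
    then have "{x, f x} = {z, f x}" using f' by metis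
    then show "x = z" by (auto simp: doubleton_eq_iff)
  qed
  then have bij: "bij_betw f X Y" using f by (intro bij_betwI_sides) auto
  have "\<not> (pref I x {x, f z} {x, f x} \<and> pref I (f z) {x, f z} {z, f z})" if xz: "x \<in> X" "z \<in> X" for x z
  proof
    assume P: "pref I x {x, f z} {x, f x} \<and> pref I (f z) {x, f z} {z, f z}"
    \<comment> \<open>A blocking edge must lie outside \<open>\<mu>\<close>, which
      \<open>stable_fun\<close> does not mention; irreflexivity of the preference supplies
      it.\<close>
    have "{x, f z} \<noteq> {x, f x}"
      using P pref_irrefl[of x "{x, f x}"] pair_in_edges_at[of x "f x"] f xz agents_eq by auto
    then have "{x, f z} \<notin> \<mu>" using edge_of_eqI[OF M, of x "{x, f z}"] f xz agents_eq by auto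
    moreover have "{x, f z} \<in> valid_edges I" using f xz valid_edges_eq by auto
    ultimately show False using st P f f' xz by (auto simp: stable_matching_def)
  qed
  then have "stable_fun f" using bij by (auto simp: stable_fun_def)
  then show thesis using that f by blast
qed

text \<open>The join of the lattice of stable matchings: each agent of \<open>X\<close> keeps the
  better of its two partners. Stability of \<open>f\<close> and \<open>g\<close> prevents two agents
  from choosing the same partner.\<close>

lemma stable_fun_join:
  assumes f: "stable_fun f" and g: "stable_fun g"
  defines "h \<equiv> \<lambda>x. if pref I x {x, f x} {x, g x} then f x else g x"
  shows "stable_fun h"
proof -
  have fY: "\<And>x. x \<in> X \<Longrightarrow> f x \<in> Y" and gY: "\<And>x. x \<in> X \<Longrightarrow> g x \<in> Y"
    and injf: "inj_on f X" and injg: "inj_on g X"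
    using f g by (auto simp: stable_fun_def bij_betw_def)
  note EX = pair_in_edges_at(1) and EY = pair_in_edges_at(2)
  \<comment> \<open>Let \<open>y\<close> be the common partner. If \<open>x\<close> and
    \<open>z\<close> differ, \<open>x\<close> strictly prefers \<open>y\<close> to
    \<open>g x\<close>, so stability of \<open>g\<close> keeps \<open>y\<close> from preferring
    \<open>x\<close> to \<open>z\<close>. Likewise \<open>z\<close> strictly prefers
    \<open>y\<close> to \<open>f z\<close>, so stability of \<open>f\<close> keeps \<open>y\<close>
    from preferring \<open>z\<close> to \<open>x\<close>. This contradicts totality at
    \<open>y\<close>.\<close>
  have no_clash: "x = z" if xz: "x \<in> X" "z \<in> X" and P: "pref I x {x, f x} {x, g x}"
    and Q: "\<not> pref I z {z, f z} {z, g z}" and eq: "f x = g z" for x z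
  proof (rule ccontr)
    assume ne: "x \<noteq> z"
    have a: "\<not> pref I (g z) {x, g z} {z, g z}" using g P eq xz by (auto simp: stable_fun_def)
    have "f z \<noteq> g z" using injf ne eq xz by (metis inj_onD)
    then have "pref I z {z, g z} {z, f z}"
      using pref_total[of z "{z, f z}" "{z, g z}"] EX fY gY xz Q agents_eq by (auto simp: doubleton_eq_iff)
    then have b: "\<not> pref I (g z) {z, g z} {x, g z}"
      using f eq xz unfolding stable_fun_def by metis
    show False using pref_total[of "g z" "{z, g z}" "{x, g z}"] a b EY gY xz agents_eq ne
      by (auto simp: doubleton_eq_iff)
  qed
  have inj: "inj_on h X"
  proof (rule inj_onI)
    fix x z assume xz: "x \<in> X" "z \<in> X" and eq: "h x = h z"
    let ?P = "\<lambda>x. pref I x {x, f x} {x, g x}"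
    consider "?P x" "?P z" "f x = f z" | "?P x" "\<not> ?P z" "f x = g z"
      | "?P z" "\<not> ?P x" "f z = g x" | "g x = g z"
      using eq unfolding h_def by presburger
    then show "x = z"
      by cases (use xz no_clash in \<open>auto dest: inj_onD[OF injf] inj_onD[OF injg]\<close>)
  qed
  have hY: "\<And>x. x \<in> X \<Longrightarrow> h x \<in> Y" using fY gY by (auto simp: h_def)
  have bij: "bij_betw h X Y" using inj hY by (intro bij_betwI_sides) auto
  \<comment> \<open>An edge beating the chosen partner beats both candidates. Hence a pair blocking
    \<open>h\<close> also blocks whichever of \<open>f\<close> and \<open>g\<close> supplies
    \<open>h z\<close>.\<close>
  have better: "pref I x {x, y} {x, f x} \<and> pref I x {x, y} {x, g x}"
    if "x \<in> X" "y \<in> Y" and P: "pref I x {x, y} {x, h x}" for x y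
  proof -
    have xA: "x \<in> agents I" using that agents_eq by auto
    note E = EX[OF \<open>x \<in> X\<close> \<open>y \<in> Y\<close>] EX[OF \<open>x \<in> X\<close> fY[OF \<open>x \<in> X\<close>]] EX[OF \<open>x \<in> X\<close> gY[OF \<open>x \<in> X\<close>]]
    show ?thesis
    proof (cases "pref I x {x, f x} {x, g x}")
      case True
      then show ?thesis using P True pref_trans[OF xA E] by (simp add: h_def)
    next
      case False
      then have "{x, f x} = {x, g x} \<or> pref I x {x, g x} {x, f x}"
        using pref_total[OF xA E(2,3)] by blast
      then show ?thesis using P False pref_trans[OF xA E(1,3,2)] by (auto simp: h_def)
    qed
  qed
  have "\<not> (pref I x {x, h z} {x, h x} \<and> pref I (h z) {x, h z} {z, h z})"
    if xz: "x \<in> X" "z \<in> X" for x z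
  proof
    assume P: "pref I x {x, h z} {x, h x} \<and> pref I (h z) {x, h z} {z, h z}"
    then have "pref I x {x, h z} {x, f x} \<and> pref I x {x, h z} {x, g x}"
      using better hY xz by blast
    moreover have "h z = f z \<or> h z = g z" by (simp add: h_def)
    ultimately show False using P f g xz unfolding stable_fun_def by metis
  qed
  then show ?thesis using bij by (auto simp: stable_fun_def)
qed

text \<open>Induction on the set of agents already improved: joining with a stable matching that
  improves one more agent preserves all earlier improvements.\<close>

lemma stable_fun_all_better:
  assumes f: "stable_fun f"
    and imp: "\<And>x. x \<in> X \<Longrightarrow> \<exists>g. stable_fun g \<and> pref I x {x, g x} {x, f x}"
  shows "\<exists>g. stable_fun g \<and> (\<forall>x\<in>X. pref I x {x, g x} {x, f x})"
proof -
  have "\<exists>g. stable_fun g \<and> (\<forall>x\<in>S. pref I x {x, g x} {x, f x})" if "S \<subseteq> X" for S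
    using finite_subset[OF that finite_sides(1)] that
  proof (induction S rule: finite_induct)
    case empty
    then show ?case using f by auto
  next
    case (insert a S)
    then obtain g where g: "stable_fun g" "\<And>x. x \<in> S \<Longrightarrow> pref I x {x, g x} {x, f x}" by auto
    obtain k where k: "stable_fun k" "pref I a {a, k a} {a, f a}" using imp insert.prems by auto
    define h where "h = (\<lambda>x. if pref I x {x, g x} {x, k x} then g x else k x)"
    have h: "stable_fun h" using stable_fun_join[OF g(1) k(1)] by (simp add: h_def)
    have "pref I x {x, h x} {x, f x}"
      if "x \<in> X" and or: "pref I x {x, g x} {x, f x} \<or> pref I x {x, k x} {x, f x}" for x
    proof -
      have xA: "x \<in> agents I" using that agents_eq by auto
      have EE: "{x, g x} \<in> edges_at I x" "{x, k x} \<in> edges_at I x" "{x, f x} \<in> edges_at I x"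
        using that(1) f g(1) k(1) by (simp_all add: pair_in_edges_at(1) stable_fun_in)
      show ?thesis
      proof (cases "pref I x {x, g x} {x, k x}")
        case True
        then show ?thesis using or pref_trans[OF xA EE True] by (auto simp: h_def)
      next
        case False
        then have "{x, g x} = {x, k x} \<or> pref I x {x, k x} {x, g x}"
          using pref_total[OF xA EE(1,2)] by blast
        then show ?thesis using or False pref_trans[OF xA EE(2,1,3)] by (auto simp: h_def)
      qed
    qed
    then have "\<forall>x\<in>insert a S. pref I x {x, h x} {x, f x}" using g(2) k(2) insert.prems by auto
    then show ?case using h by blast
  qed
  then show ?thesis by blast
qed

section \<open>Intermediate matchings and loops in ordinal bases\<close>

lemma intermediate_improving_edge:
  assumes im: "intermediate I \<mu>" and v: "v \<in> Y"
  shows "\<exists>x\<in>X. pref I x {x, v} (edge_of \<mu> x)"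
proof -
  have st: "stable_matching I \<mu>" using im by (simp add: intermediate_def)
  obtain f where f: "stable_fun f" "\<And>x. x \<in> X \<Longrightarrow> edge_of \<mu> x = {x, f x}"
    by (rule stable_funE[OF st]) blast
  \<comment> \<open>Failure of optimality for \<open>x\<close> only yields a different edge that is
    not worse; totality makes it strictly better.\<close>
  have imp: "\<exists>g. stable_fun g \<and> pref I x {x, g x} {x, f x}" if x: "x \<in> X" for x
  proof -
    have xA: "x \<in> agents I" using x agents_eq by auto
    obtain \<nu> where \<nu>: "stable_matching I \<nu>" "edge_of \<nu> x \<noteq> edge_of \<mu> x"
      "\<not> pref I x (edge_of \<mu> x) (edge_of \<nu> x)"
      using im xA st unfolding intermediate_def optimal_for_def by blast
    obtain g where g: "stable_fun g" "\<And>x. x \<in> X \<Longrightarrow> edge_of \<nu> x = {x, g x}"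
      by (rule stable_funE[OF \<nu>(1)]) blast
    have "{x, g x} \<in> edges_at I x" "{x, f x} \<in> edges_at I x"
      using x f(1) g(1) by (simp_all add: pair_in_edges_at(1) stable_fun_in)
    then have "pref I x {x, g x} {x, f x}"
      using pref_total[OF xA, of "{x, g x}" "{x, f x}"] \<nu> f(2)[OF x] g(2)[OF x] by metis
    then show ?thesis using g(1) by blast
  qed
  from stable_fun_all_better[OF f(1) imp]
  obtain g where g: "stable_fun g" "\<And>x. x \<in> X \<Longrightarrow> pref I x {x, g x} {x, f x}" by auto
  \<comment> \<open>The improving matching is onto \<open>Y\<close>, so \<open>v\<close> has a
    partner in it.\<close>
  obtain x where "x \<in> X" "g x = v" using v g(1) by (auto simp: stable_fun_def bij_betw_def)
  then show ?thesis using g(2) f(2) by auto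
qed

text \<open>The loop at agent \<open>v\<close> is column \<open>v\<close>, so the conclusion is
  about a column. The hypothesis \<open>sub\<close> puts every column of \<open>\<mu>\<close> into
  \<open>D\<close>.\<close>

lemma loop_notin_ordinal_basis:
  assumes C: "ordinal_matrix (nagents I) (nvalid I) C" "consistent I C"
    and im: "intermediate I \<mu>"
    and D: "ordinal_basis C D"
    and sub: "\<And>j. j < nagents I + nvalid I \<Longrightarrow> edge I j \<in> \<mu> \<Longrightarrow> j \<in> D"
    and v: "v \<in> Y"
  shows "v \<notin> D"
proof
  assume vD: "v \<in> D"
  let ?n = "nagents I" and ?N = "nagents I + nvalid I"
  have M: "matching I \<mu>" using im by (simp add: intermediate_def stable_matching_def)
  obtain x where x: "x \<in> X" "pref I x {x, v} (edge_of \<mu> x)"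
    using intermediate_improving_edge[OF im v] by blast
  have dims: "dim_row C = ?n" "dim_col C = ?N" using C by (auto simp: ordinal_matrix_def)
  have "{x, v} \<in> valid_edges I" using x v valid_edges_eq by auto
  then obtain h where h: "?n \<le> h" "h < ?N" "edge I h = {x, v}" by (auto simp: valid_edges_def)
  obtain i where i: "i < ?n" "C $$ (i, h) \<le> Min ((\<lambda>j. C $$ (i, j)) ` D)"
    using D h dims by (auto simp: ordinal_basis_def)
  have "finite D" using D by (auto simp: ordinal_basis_def intro: finite_subset)
  then have le: "C $$ (i, h) \<le> C $$ (i, j)" if "j \<in> D" for j
    using i(2) that by (meson Min_le dual_order.trans finite_imageI imageI)
  have iA: "i \<in> agents I" using i by (simp add: agents_def)
  have "edge_of \<mu> i \<in> edges I" using edge_of_matching[OF M iA] M by (auto simp: matching_def)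
  \<comment> \<open>Column \<open>k\<close>, the edge of \<open>i\<close> in \<open>\<mu>\<close>,
    lies in \<open>D\<close> and refutes domination by row \<open>i\<close> unless
    \<open>i = v\<close>; in that case column \<open>v\<close> takes its place.\<close>
  then obtain k where k: "k < ?N" "edge I k = edge_of \<mu> i" by (auto simp: edges_def)
  have ik: "i \<in> edge I k" and kD: "k \<in> D" using edge_of_matching[OF M iA] k sub by auto
  have cons1: "i \<notin> edge I h \<Longrightarrow> C $$ (i, k) < C $$ (i, h)"
    and cons2: "i \<in> edge I h \<Longrightarrow> pref I i (edge I h) (edge I k) \<Longrightarrow> C $$ (i, k) < C $$ (i, h)"
    using C(2) i(1) k(1) h(2) ik unfolding consistent_def by blast+
  consider "i \<notin> {x, v}" | "i = x" | "i = v" by auto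
  then show False
  proof cases
    case 1
    then show False using cons1 h le[OF kD] by auto
  next
    case 2
    then show False using cons2 h x k le[OF kD] by auto
  next
    case 3
    have vn: "v < ?n" using 3 i by simp
    then have "edge I v = {v}" using inst by (auto simp: marriage_instance_def)
    moreover have "pref I v {x, v} {v}"
      using pref_loop[of v "{x, v}"] pair_in_edges_at[OF x(1) v] iA 3 x v disjoint by auto
    ultimately have "C $$ (i, v) < C $$ (i, h)"
      using C(2) i(1) h vn 3 unfolding consistent_def by (metis insertCI trans_less_add1)
    then show False using le[OF vD] by simp
  qed
qed

end

section \<open>Row dependence of the bipartite incidence matrix\<close>

lemma column_basis_contains_loop:
  assumes inst: "marriage_instance I" and B: "column_basis (induced_A I) B"
  shows "\<exists>v\<in>agents I. v \<in> B"
proof (rule ccontr)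
  assume no: "\<not> ?thesis"
  let ?n = "nagents I" and ?A = "induced_A I" and ?M = "basis_mat (induced_A I) B"
  have dims: "dim_row ?A = ?n" "dim_col ?A = ?n + nvalid I" by (auto simp: induced_A_def)
  have Bsub: "B \<subseteq> {0..<?n + nvalid I}" "card B = ?n" using B dims by (auto simp: column_basis_def)
  have cols: "{j. j < dim_col ?A \<and> j \<in> B} = B" using Bsub dims by auto
  have M: "?M \<in> carrier_mat ?n ?n" using cols Bsub dims by (auto simp: dim_submatrix)
  obtain R where R: "inverts_mat ?M R" "inverts_mat R ?M"
    using B by (auto simp: column_basis_def invertible_mat_def)
  have MR: "?M * R = 1\<^sub>m ?n" using R(1) M by (simp add: inverts_mat_def)
  have RM: "R * ?M = 1\<^sub>m (dim_row R)" using R(2) by (simp add: inverts_mat_def)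
  \<comment> \<open>The two inverse identities determine the dimensions of \<open>R\<close>.\<close>
  have Rc: "R \<in> carrier_mat ?n ?n"
    using arg_cong[OF MR, of dim_col] arg_cong[OF RM, of dim_col] M by auto
  \<comment> \<open>The signed indicator of the sides: each valid edge contains one man and one
    woman, so \<open>z\<close> annihilates every column of \<open>?M\<close>.\<close>
  define z :: "real vec" where "z = vec ?n (\<lambda>i. if i \<in> men I then 1 else -1)"
  have z: "z \<in> carrier_vec ?n" by (simp add: z_def)
  have zM: "transpose_mat ?M *\<^sub>v z = 0\<^sub>v ?n"
  proof (rule eq_vecI)
    show "dim_vec (transpose_mat ?M *\<^sub>v z) = dim_vec (0\<^sub>v ?n)" using M by auto
    fix k assume "k < dim_vec (0\<^sub>v ?n :: real vec)"
    then have k: "k < ?n" by simp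
    have pk: "pick B k \<in> B" using k Bsub by (intro pick_in_set) auto
    have pn: "?n \<le> pick B k" "pick B k < ?n + nvalid I"
      using no pk Bsub by (auto simp: agents_def not_less)
    have "edge I (pick B k) \<in> {{a, b} | a b. a \<in> men I \<and> b \<in> women I}"
      using inst pn unfolding marriage_instance_def bij_betw_def
      by (metis (no_types, lifting) atLeastLessThan_iff imageI)
    then obtain a b where ab: "a \<in> men I" "b \<in> women I" "edge I (pick B k) = {a, b}" by blast
    have abn: "a < ?n" "b < ?n" "a \<noteq> b" "b \<notin> men I"
      using inst ab by (auto simp: marriage_instance_def agents_def set_eq_iff)
    have entry: "?M $$ (i, k) = (if i \<in> {a, b} then 1 else 0)" if "i < ?n" for i
    proof -
      have "?M $$ (i, k) = ?A $$ (pick UNIV i, pick B k)"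
        using that k dims cols Bsub by (intro submatrix_index) auto
      then show ?thesis using that pn ab by (simp add: pick_UNIV induced_A_def)
    qed
    have "(transpose_mat ?M *\<^sub>v z) $ k = (\<Sum>i\<in>{0..<?n}. ?M $$ (i, k) * z $ i)"
      using M k by (auto simp: scalar_prod_def z_def intro!: sum.cong)
    also have "\<dots> = (\<Sum>i\<in>{0..<?n}. if i \<in> {a, b} then z $ i else 0)"
      using entry by (intro sum.cong) auto
    also have "\<dots> = (\<Sum>i\<in>{a, b}. z $ i)"
      using abn by (subst sum.inter_restrict[symmetric]) (auto intro!: sum.cong)
    also have "\<dots> = 0" using ab abn by (simp add: z_def)
    finally show "(transpose_mat ?M *\<^sub>v z) $ k = 0\<^sub>v ?n $ k" using k by simp
  qed
  have "z = transpose_mat (?M * R) *\<^sub>v z" using z by (simp add: MR)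
  also have "\<dots> = transpose_mat R *\<^sub>v (transpose_mat ?M *\<^sub>v z)"
    using M Rc z by (simp add: transpose_mult[OF M Rc] assoc_mult_mat_vec[of _ ?n ?n _ ?n])
  also have "\<dots> = 0\<^sub>v ?n" using Rc by (auto simp: zM)
  \<comment> \<open>Agent 0 exists because the instance is nonempty, and its entry in
    \<open>z\<close> is 1 or -1.\<close>
  finally have "z $ 0 = (0\<^sub>v ?n :: real vec) $ 0" by simp
  then show False using inst by (auto simp: z_def marriage_instance_def split: if_splits)
qed

theorem theorem9:
  fixes I :: marriage and C :: "int mat" and \<mu> :: "nat set set"
  assumes "marriage_instance I"
    and "card (men I) = card (women I)"
    and "ordinal_matrix (nagents I) (nvalid I) C"
    and "consistent I C"
    and "stable_matching I \<mu>"
    and "intermediate I \<mu>"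
  shows "\<not> (\<exists>x. dominating_vertex (induced_A I) (induced_b I) C x \<and> x = char_vec I \<mu>)"
proof
  assume "\<exists>x. dominating_vertex (induced_A I) (induced_b I) C x \<and> x = char_vec I \<mu>"
  then obtain D where bfs: "basic_feasible_solution (induced_A I) (induced_b I) D (char_vec I \<mu>)"
    and D: "ordinal_basis C D"
    by (auto simp: dominating_vertex_def)
  \<comment> \<open>The vertex vanishes off its basis, whereas the characteristic vector is 1 on the
    columns of \<open>\<mu>\<close>.\<close>
  have sub: "j \<in> D" if "j < nagents I + nvalid I" "edge I j \<in> \<mu>" for j
  proof (rule ccontr)
    assume "j \<notin> D"
    then have "char_vec I \<mu> $ j = 0"
      using bfs that by (auto simp: basic_feasible_solution_def induced_A_def)
    then show False using that by (simp add: char_vec_def)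
  qed
  interpret mw: market_sides I "men I" "women I"
    using assms by unfold_locales auto
  interpret wm: market_sides I "women I" "men I"
    using assms by unfold_locales auto
  have "column_basis (induced_A I) D" using bfs by (simp add: basic_feasible_solution_def)
  then obtain v where v: "v \<in> agents I" "v \<in> D"
    using column_basis_contains_loop[OF assms(1)] by blast
  then show False
    using mw.loop_notin_ordinal_basis[OF assms(3,4,6) D sub]
      wm.loop_notin_ordinal_basis[OF assms(3,4,6) D sub] mw.agents_eq by blast
qed

end
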